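(* Let $a>1$ be an integer. If $n$ is an overpseudoprime to base $a$, then $n$ is a strong pseudoprime to base $a$.
   Context: For an integer $m>1$ with $\gcd(m,a)=1$, $h_a(m)$ denotes the multiplicative order of $a$ modulo $m$. The cyclotomic cosets of $a$ modulo $m$ are the orbits of $\{1,2,\ldots,m-1\}$ under $x\mapsto ax\bmod m$; $r_a(m)$ denotes their number. An odd composite number $n$ with $\gcd(n,a)=1$ is called an overpseudoprime to base $a$ if $n=r_a(n)h_a(n)+1$. An odd composite $n$, with $n-1=2^s d$ where $d$ is odd, is a strong pseudoprime to base $a$ if either $a^{d}\equiv 1\pmod n$ or $a^{2^k d}\equiv -1\pmod n$ for some $k$ with $0\le k\le s-1$. *)

theory Defs
  imports "HOL-Number_Theory.Number_Theory" "HOL-Combinatorics.Orbits"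
begin

(* The library's orbit f x is {f x, f (f x), ...}. For a coprime to m, multiplication by a
   permutes {1..<m}, so x itself belongs to orbit f x and these sets are the usual orbits. *)
definition cyclotomic_cosets :: "nat \<Rightarrow> nat \<Rightarrow> nat set set" where
  "cyclotomic_cosets a m = orbit (\<lambda>x. a * x mod m) ` {1..<m}"

definition num_cyclotomic_cosets :: "nat \<Rightarrow> nat \<Rightarrow> nat" where
  "num_cyclotomic_cosets a m = card (cyclotomic_cosets a m)"

definition odd_composite :: "nat \<Rightarrow> bool" where
  "odd_composite n \<longleftrightarrow> odd n \<and> n > 1 \<and> \<not> prime n"

(* ord n a takes the modulus first. *)
definition overpseudoprime :: "nat \<Rightarrow> nat \<Rightarrow> bool" where
  "overpseudoprime a n \<longleftrightarrow>
     odd_composite n \<and> coprime n a \<and> n = num_cyclotomic_cosets a n * ord n a + 1"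

(* The pair (s, d) is uniquely determined by n > 1. The second congruence is
   stated over the integers because of the residue -1. *)
definition strong_pseudoprime :: "nat \<Rightarrow> nat \<Rightarrow> bool" where
  "strong_pseudoprime a n \<longleftrightarrow>
     odd_composite n \<and>
     (\<exists>s d. n - 1 = 2 ^ s * d \<and> odd d \<and>
        ([a ^ d = 1] (mod n) \<or>
         (\<exists>k<s. [int a ^ (2 ^ k * d) = - 1] (mod int n))))"

end

theory Submission
  imports Defs
begin

text \<open>Multiplication by \<open>a\<close> sends every residue back to itself after \<open>h = ord n a\<close> steps, so each
  coset has at most \<open>h\<close> elements; since the cosets cover \<open>n - 1 = r h\<close> residues, none has fewer.
  If \<open>h\<close> is even and \<open>g = gcd (a\<^bsup>h/2\<^esup> - 1) n > 1\<close>, the coset of \<open>n / g\<close> would have at most \<open>h / 2\<close>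
  elements. Hence \<open>a\<^bsup>h/2\<^esup> - 1\<close> is coprime to \<open>n\<close>, and \<open>n\<close> divides \<open>a\<^bsup>h/2\<^esup> + 1\<close>.\<close>

lemma card_orbit_le:
  assumes "(f ^^ j) x = x" "j > 0"
  shows "card (orbit f x) \<le> j"
proof -
  have "orbit f x = (\<lambda>i. (f ^^ i) x) ` {..<j}"
    using orbit_altdef_bounded[OF assms] by auto
  then show ?thesis
    using card_image_le[of "{..<j}" "\<lambda>i. (f ^^ i) x"] by simp
qed

text \<open>\<open>orbit f x\<close> starts at \<open>f x\<close>, so \<open>x\<close> lies in it
  only once the iteration returns. This is what makes the cosets cover all residues and stay
  finite.\<close>

lemma mem_orbit_if_funpow_fixed:
  assumes "(f ^^ j) x = x" "j > 0"
  shows "x \<in> orbit f x"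
  using assms by (metis (mono_tags, lifting) mem_Collect_eq orbit_altdef)

lemma funpow_mult_mod:
  fixes a m x :: nat
  assumes "x < m"
  shows "((\<lambda>x. a * x mod m) ^^ i) x = a ^ i * x mod m"
  using assms by (induction i) (simp_all add: mod_mult_right_eq mult.assoc)

text \<open>The cosets need not be known to be disjoint: covering \<open>{1..<n}\<close> is enough for the count.\<close>

lemma ord_le_if_fixed:
  assumes over: "overpseudoprime a n" and x: "x \<in> {1..<n}"
    and j: "j > 0" "[a ^ j * x = x] (mod n)"
  shows "ord n a \<le> j"
proof (rule ccontr)
  assume "\<not> ord n a \<le> j"
  then have less: "j < ord n a" by simp
  define f where "f = (\<lambda>x. a * x mod n)"
  have n: "n = card (orbit f ` {1..<n}) * ord n a + 1"
    using over by (simp add: overpseudoprime_def num_cyclotomic_cosets_def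
        cyclotomic_cosets_def f_def)
  have fixed: "(f ^^ i) y = y" if "y < n" "[a ^ i * y = y] (mod n)" for i y
    using that by (simp add: f_def funpow_mult_mod cong_def)
  have h: "(f ^^ ord n a) y = y" if "y < n" for y
    using cong_scalar_right[OF ord[of a n], of y] by (intro fixed that) (simp only: mult_1)
  have h0: "ord n a > 0" using less by linarith
  define C where "C = orbit f ` {1..<n}"
  have "{1..<n} \<subseteq> \<Union>C"
    unfolding C_def using mem_orbit_if_funpow_fixed[OF h h0] by fastforce
  moreover have "finite (\<Union>C)"
    unfolding C_def using finite_orbit[OF mem_orbit_if_funpow_fixed[OF h h0]] by auto
  ultimately have "card {1..<n} \<le> card (\<Union>C)"
    by (intro card_mono)
  then have "n - 1 \<le> card (\<Union>C)" by simp
  also have "\<dots> \<le> (\<Sum>A\<in>C. card A)"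
    by (intro card_Union_le_sum_card)
  also have "\<dots> < (\<Sum>A\<in>C. ord n a)"
  proof (rule sum_strict_mono_ex1)
    show "finite C" by (simp add: C_def)
    show "\<forall>A\<in>C. card A \<le> ord n a"
      unfolding C_def using card_orbit_le[OF h h0] by auto
    \<comment> \<open>Strictness comes from the coset of \<open>x\<close> alone, which closes up
      after \<open>j < ord n a\<close> steps.\<close>
    have "card (orbit f x) \<le> j"
      using x j by (intro card_orbit_le fixed) auto
    then show "\<exists>A\<in>C. card A < ord n a"
      using x less unfolding C_def by force
  qed
  also have "\<dots> = n - 1"
    using n by (simp add: C_def)
  finally show False by simp
qed

text \<open>Modulo a composite \<open>n\<close> a square root of 1 may differ from 1 and -1; that no
  coset is shorter than \<open>ord n a\<close> forces -1 here.\<close>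

lemma dvd_power_half_ord_plus_one:
  assumes over: "overpseudoprime a n" and h: "ord n a = 2 * j"
  shows "n dvd a ^ j + 1"
proof -
  have n: "n > 1" "coprime n a"
    using over by (auto simp: overpseudoprime_def odd_composite_def)
  then have j0: "j > 0"
    using h by (metis ord_eq_0 mult_is_0 neq0_conv)
  have a0: "a > 0"
    using n by (cases a) auto
  define g where "g = gcd (a ^ j - 1) n"
  obtain x where x: "n = g * x"
    unfolding g_def by (metis dvdE gcd_dvd2)
  have "g = 1"
  proof (rule ccontr)
    assume "g \<noteq> 1"
    \<comment> \<open>As \<open>g > 1\<close>, the cofactor \<open>x = n / g\<close> is a nonzero
      residue, and multiplication by \<open>a ^ j\<close> fixes it because \<open>g\<close> divides
      \<open>a ^ j - 1\<close>.\<close>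
    then have "x \<in> {1..<n}"
      using x n by (cases g; cases x) auto
    moreover have "g dvd a ^ j - 1" by (simp add: g_def)
    then have "n dvd (a ^ j - 1) * x"
      using x by (simp add: mult_dvd_mono)
    then have "[a ^ j * x = x] (mod n)"
      using a0 by (simp add: cong_altdef_nat diff_mult_distrib)
    ultimately have "ord n a \<le> j"
      by (rule ord_le_if_fixed[OF over _ j0])
    then show False using h j0 by simp
  qed
  moreover have "n dvd a ^ (2 * j) - 1"
    using ord[of a n] h a0 by (simp add: cong_altdef_nat)
  moreover have "a ^ (2 * j) - 1 = (a ^ j - 1) * (a ^ j + 1)"
    by (simp add: algebra_simps power_mult power2_eq_square power_add mult_2)
  ultimately show ?thesis
    unfolding g_def by (metis coprime_commute coprime_dvd_mult_right_iff coprime_iff_gcd_eq_1)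
qed

theorem theorem12:
  fixes a n :: nat
  assumes "a > 1"
    and "overpseudoprime a n"
  shows "strong_pseudoprime a n"
proof -
  define h where "h = ord n a"
  have n: "odd_composite n" "n > 1" "n - 1 = num_cyclotomic_cosets a n * h"
    using assms(2) unfolding overpseudoprime_def odd_composite_def h_def by linarith+
  have "n - 1 \<noteq> 0" using n(2) by simp
  then obtain s d where sd: "n - 1 = 2 ^ s * d" "odd d"
    using multiplicity_decompose'[of "n - 1" 2]
    by (metis not_prime_unit two_is_prime_nat)
  have dvd: "h dvd 2 ^ s * d"
    unfolding sd(1)[symmetric] n(3) by simp
  have "[a ^ d = 1] (mod n) \<or> (\<exists>k<s. [int a ^ (2 ^ k * d) = - 1] (mod int n))"
  proof (cases "odd h")
    case True
    then have "coprime h (2 ^ s)" by simp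
    then have "h dvd d"
      using dvd by (simp add: coprime_dvd_mult_right_iff)
    then have "[a ^ d = 1] (mod n)"
      by (simp only: h_def ord_divides)
    then show ?thesis ..
  next
    case False
    have "h \<noteq> 0" using n by (intro notI) simp
    then obtain t e where te: "h = 2 ^ t * e" "odd e"
      using multiplicity_decompose'[of h 2]
      by (metis not_prime_unit two_is_prime_nat)
    \<comment> \<open>Halving \<open>h\<close> leaves \<open>2 ^ k * e\<close>, so \<open>k\<close>
      is the required exponent; the shift by one turns \<open>t \<le> s\<close> into
      \<open>k < s\<close>.\<close>
    then obtain k where k: "t = Suc k"
      using False by (cases t) auto
    have "k < s"
    proof -
      have "2 ^ t dvd 2 ^ s * d"
        using dvd te by (metis dvd_mult_left)
      then have "(2::nat) ^ t dvd 2 ^ s"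
        using sd by (simp add: coprime_dvd_mult_left_iff)
      then have "t \<le> s"
        by (rule power_dvd_imp_le) simp
      then show ?thesis using k by simp
    qed
    moreover have "[int a ^ (2 ^ k * d) = - 1] (mod int n)"
    proof -
      have "e dvd 2 ^ s * d"
        using dvd te by (metis dvd_mult_right)
      then have "e dvd d"
        using te by (simp add: coprime_dvd_mult_right_iff)
      \<comment> \<open>\<open>c\<close> is odd because \<open>d\<close> is, so raising the
        congruence for \<open>2 ^ k * e\<close> to the power \<open>c\<close> reaches
        \<open>2 ^ k * d\<close> and keeps the sign.\<close>
      then obtain c where c: "d = e * c" by blast
      have "n dvd a ^ (2 ^ k * e) + 1"
        using te k by (intro dvd_power_half_ord_plus_one assms) (simp add: h_def)
      then have "int n dvd int a ^ (2 ^ k * e) + 1"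
        by (metis of_nat_1 of_nat_add of_nat_dvd_iff of_nat_power)
      then have "[int a ^ (2 ^ k * e) = - 1] (mod int n)"
        by (simp add: cong_iff_dvd_diff)
      then have "[(int a ^ (2 ^ k * e)) ^ c = (- 1) ^ c] (mod int n)"
        by (rule cong_pow)
      then show ?thesis
        using sd c by (simp add: power_mult mult.assoc)
    qed
    ultimately show ?thesis by blast
  qed
  then show ?thesis
    using n sd by (auto simp: strong_pseudoprime_def)
qed

end
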